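(* Suppose $\frac{2\delta}{\mu}<\alpha$ and $M_0(\alpha)<M\le M_\alpha$. Then the function $$V(x)=\begin{cases}k_1(\alpha,\beta)\left(e^{r_+(\alpha)x}-e^{r_-(\alpha)x}\right), & 0\le x<x_1,\\[1mm] \dfrac{M}{\gamma}+\dfrac{1}{\tilde r_-(\alpha)}e^{\tilde r_-(\alpha)(x-x_1)}, & x\ge x_1,\end{cases}$$ (with all quantities as defined in the context) is a concave, twice continuously differentiable solution on $[0,\infty)$ of the HJB equation $$0=\max_{\alpha\le a\le\beta}\left(\tfrac12\sigma^2a^2V''(x)+(a\mu-\delta)V'(x)-\gamma V(x)+M(1-V'(x))^+\right),\qquad V(0)=0,$$ and it satisfies $0\le V(x)\le\frac{M}{\gamma}$ for all $x>0$.
   Context: Parameters: real constants $\mu>0$, $\sigma>0$, $\gamma>0$, $\delta\ge0$, $M>0$, $0<\alpha<\beta<\infty$; $y^+=\max(y,0)$. $r_\pm(\alpha)=\dfrac{-(\alpha\mu-\delta)\pm\sqrt{(\alpha\mu-\delta)^2+2\gamma\sigma^2\alpha^2}}{\sigma^2\alpha^2}$, $\quad\tilde r_-(\alpha)=\dfrac{-(\alpha\mu-\delta-M)-\sqrt{(\alpha\mu-\delta-M)^2+2\gamma\sigma^2\alpha^2}}{\sigma^2\alpha^2}$. $M_\alpha=\left(\alpha-\dfrac{2\delta\mu}{\mu^2+2\gamma\sigma^2}\right)\dfrac{\mu^2+2\gamma\sigma^2}{2\mu}$, $\quad M_0(\alpha)=\dfrac{\alpha^2\sigma^2\gamma}{2(\alpha\mu-\delta)}$.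 $x_1=\dfrac{1}{r_+(\alpha)-r_-(\alpha)}\log\left(\dfrac{r_-(\alpha)(r_-(\alpha)-\tilde r_-(\alpha))}{r_+(\alpha)(r_+(\alpha)-\tilde r_-(\alpha))}\right)$. $k_1(\alpha,\beta)$ is determined by $k_1(\alpha,\beta)\left(r_+(\alpha)e^{r_+(\alpha)x_1}-r_-(\alpha)e^{r_-(\alpha)x_1}\right)=1$. *)

theory Defs
  imports "HOL-Analysis.Analysis"
begin

definition r_plus :: "real \<Rightarrow> real \<Rightarrow> real \<Rightarrow> real \<Rightarrow> real \<Rightarrow> real" where
  "r_plus \<mu> \<sigma> \<gamma> \<delta> \<alpha> =
     (- (\<alpha> * \<mu> - \<delta>) + sqrt ((\<alpha> * \<mu> - \<delta>)\<^sup>2 + 2 * \<gamma> * \<sigma>\<^sup>2 * \<alpha>\<^sup>2)) / (\<sigma>\<^sup>2 * \<alpha>\<^sup>2)"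

definition r_minus :: "real \<Rightarrow> real \<Rightarrow> real \<Rightarrow> real \<Rightarrow> real \<Rightarrow> real" where
  "r_minus \<mu> \<sigma> \<gamma> \<delta> \<alpha> =
     (- (\<alpha> * \<mu> - \<delta>) - sqrt ((\<alpha> * \<mu> - \<delta>)\<^sup>2 + 2 * \<gamma> * \<sigma>\<^sup>2 * \<alpha>\<^sup>2)) / (\<sigma>\<^sup>2 * \<alpha>\<^sup>2)"

definition rt_minus :: "real \<Rightarrow> real \<Rightarrow> real \<Rightarrow> real \<Rightarrow> real \<Rightarrow> real \<Rightarrow> real" where
  "rt_minus \<mu> \<sigma> \<gamma> \<delta> M \<alpha> =
     (- (\<alpha> * \<mu> - \<delta> - M) - sqrt ((\<alpha> * \<mu> - \<delta> - M)\<^sup>2 + 2 * \<gamma> * \<sigma>\<^sup>2 * \<alpha>\<^sup>2)) / (\<sigma>\<^sup>2 * \<alpha>\<^sup>2)"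

definition M_upper :: "real \<Rightarrow> real \<Rightarrow> real \<Rightarrow> real \<Rightarrow> real \<Rightarrow> real" where
  "M_upper \<mu> \<sigma> \<gamma> \<delta> \<alpha> =
     (\<alpha> - 2 * \<delta> * \<mu> / (\<mu>\<^sup>2 + 2 * \<gamma> * \<sigma>\<^sup>2)) * ((\<mu>\<^sup>2 + 2 * \<gamma> * \<sigma>\<^sup>2) / (2 * \<mu>))"

definition M_zero :: "real \<Rightarrow> real \<Rightarrow> real \<Rightarrow> real \<Rightarrow> real \<Rightarrow> real" where
  "M_zero \<mu> \<sigma> \<gamma> \<delta> \<alpha> = \<alpha>\<^sup>2 * \<sigma>\<^sup>2 * \<gamma> / (2 * (\<alpha> * \<mu> - \<delta>))"

definition x_one :: "real \<Rightarrow> real \<Rightarrow> real \<Rightarrow> real \<Rightarrow> real \<Rightarrow> real \<Rightarrow> real" where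
  "x_one \<mu> \<sigma> \<gamma> \<delta> M \<alpha> =
     (let rp = r_plus \<mu> \<sigma> \<gamma> \<delta> \<alpha>; rm = r_minus \<mu> \<sigma> \<gamma> \<delta> \<alpha>; rt = rt_minus \<mu> \<sigma> \<gamma> \<delta> M \<alpha>
      in 1 / (rp - rm) * ln (rm * (rm - rt) / (rp * (rp - rt))))"

text \<open>The determining equation does not involve \<open>\<beta>\<close>, so neither does the constant
  \<open>k\<^sub>1(\<alpha>,\<beta>)\<close>.\<close>

definition k_one :: "real \<Rightarrow> real \<Rightarrow> real \<Rightarrow> real \<Rightarrow> real \<Rightarrow> real \<Rightarrow> real" where
  "k_one \<mu> \<sigma> \<gamma> \<delta> M \<alpha> =
     (let rp = r_plus \<mu> \<sigma> \<gamma> \<delta> \<alpha>; rm = r_minus \<mu> \<sigma> \<gamma> \<delta> \<alpha>; x1 = x_one \<mu> \<sigma> \<gamma> \<delta> M \<alpha>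
      in THE k. k * (rp * exp (rp * x1) - rm * exp (rm * x1)) = 1)"

text \<open>Only the values at \<open>x \<ge> 0\<close> are meaningful.\<close>

definition V_cand :: "real \<Rightarrow> real \<Rightarrow> real \<Rightarrow> real \<Rightarrow> real \<Rightarrow> real \<Rightarrow> real \<Rightarrow> real" where
  "V_cand \<mu> \<sigma> \<gamma> \<delta> M \<alpha> x =
     (let rp = r_plus \<mu> \<sigma> \<gamma> \<delta> \<alpha>; rm = r_minus \<mu> \<sigma> \<gamma> \<delta> \<alpha>; rt = rt_minus \<mu> \<sigma> \<gamma> \<delta> M \<alpha>;
          x1 = x_one \<mu> \<sigma> \<gamma> \<delta> M \<alpha>
      in if x < x1 then k_one \<mu> \<sigma> \<gamma> \<delta> M \<alpha> * (exp (rp * x) - exp (rm * x))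
         else M / \<gamma> + 1 / rt * exp (rt * (x - x1)))"

text \<open>\<open>f\<close> is twice continuously differentiable on \<open>S\<close> with derivatives \<open>f1\<close>, \<open>f2\<close>. Derivatives
  are taken within \<open>S\<close>, hence one-sided at the boundary point of \<open>[0,\<infinity>)\<close>; there they determine
  \<open>f1\<close> and \<open>f2\<close> uniquely.\<close>

definition has_C2_derivs_on :: "(real \<Rightarrow> real) \<Rightarrow> (real \<Rightarrow> real) \<Rightarrow> (real \<Rightarrow> real) \<Rightarrow> real set \<Rightarrow> bool" where
  "has_C2_derivs_on f f1 f2 S \<longleftrightarrow>
     (\<forall>x\<in>S. (f has_real_derivative f1 x) (at x within S)) \<and>
     (\<forall>x\<in>S. (f1 has_real_derivative f2 x) (at x within S)) \<and>
     continuous_on S f2"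

text \<open>Attained maximum of a possibly infinite set.\<close>

definition is_maximum :: "real \<Rightarrow> real set \<Rightarrow> bool" where
  "is_maximum m A \<longleftrightarrow> m \<in> A \<and> (\<forall>y\<in>A. y \<le> m)"

text \<open>The expression maximised in the HJB equation, with \<open>v\<close>, \<open>v1\<close>, \<open>v2\<close> standing for
  \<open>V(x)\<close>, \<open>V'(x)\<close>, \<open>V''(x)\<close>.\<close>

definition HJB_op ::
  "real \<Rightarrow> real \<Rightarrow> real \<Rightarrow> real \<Rightarrow> real \<Rightarrow> real \<Rightarrow> real \<Rightarrow> real \<Rightarrow> real \<Rightarrow> real" where
  "HJB_op \<mu> \<sigma> \<gamma> \<delta> M a v v1 v2 =
     1 / 2 * \<sigma>\<^sup>2 * a\<^sup>2 * v2 + (a * \<mu> - \<delta>) * v1 - \<gamma> * v + M * max (1 - v1) 0"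

end

theory Submission
  imports Defs
begin

text \<open>
  Put \<open>s = \<sigma>\<^sup>2\<alpha>\<^sup>2\<close> and \<open>c = \<alpha>\<mu> - \<delta>\<close>. With the control held at \<open>a = \<alpha>\<close>, the two branches of the
  candidate solve the linear equations \<open>s/2 V'' + c V' - \<gamma> V = 0\<close> and
  \<open>s/2 V'' + (c - M) V' - \<gamma> V + M = 0\<close>; the numbers \<open>r\<^sub>\<plusminus>\<close> and \<open>r\<close> (for \<open>\<tilde>r\<^sub>-\<close>) are characteristic
  roots of these. The constants \<open>k\<close> and \<open>x\<^sub>1\<close> are chosen so that \<open>V'\<close> and \<open>V''\<close> match at \<open>x\<^sub>1\<close>, where
  \<open>V' = 1\<close> and \<open>V'' = r\<close>; the two equations then force the values of \<open>V\<close> to match as well.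

  Everything else follows from one differential inequality, valid on the whole real line:
  \<open>V' > 0\<close> and \<open>V'' \<le> r V'\<close> with \<open>r < 0\<close>. To the right of \<open>x\<^sub>1\<close> the second relation is an equality;
  to the left, \<open>V'' - r V'\<close> is a positive multiple of
  \<open>r\<^sub>+(r\<^sub>+ - r) exp (r\<^sub>+ x) - r\<^sub>-(r\<^sub>- - r) exp (r\<^sub>- x)\<close>, an increasing function that vanishes at \<open>x\<^sub>1\<close>.
  Hence \<open>V\<close> is increasing and concave, \<open>V' \<ge> 1\<close> before \<open>x\<^sub>1\<close> and \<open>V' \<le> 1\<close> after it, so the term
  \<open>M (1 - V')\<^sup>+\<close> switches on exactly where the second equation takes over, and \<open>a = \<alpha>\<close> gives the
  value \<open>0\<close> in the HJB expression. That expression is a concave quadratic in \<open>a\<close>; it is nonincreasing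
  on \<open>a \<ge> \<alpha>\<close> as soon as \<open>\<sigma>\<^sup>2\<alpha> V'' + \<mu> V' \<le> 0\<close>, for which \<open>\<sigma>\<^sup>2\<alpha> r + \<mu> \<le> 0\<close> is enough.

  The two bounds on \<open>M\<close> say where \<open>r\<close> lies. A number \<open>y < 0\<close> is below the negative root of a
  quadratic with negative constant term and positive leading coefficient exactly when the quadratic
  is positive at \<open>y\<close> (\<open>less_negative_root_iff\<close>). Taking \<open>y = r\<^sub>-\<close> gives \<open>r\<^sub>- < r\<close>; taking
  \<open>y = - 2c/s = r\<^sub>+ + r\<^sub>-\<close> turns the lower bound on \<open>M\<close> into \<open>r\<^sub>+ + r\<^sub>- < r\<close>, which is \<open>x\<^sub>1 > 0\<close>;
  taking \<open>y = - \<mu>/(\<sigma>\<^sup>2\<alpha>)\<close> turns the upper bound on \<open>M\<close> into \<open>\<sigma>\<^sup>2\<alpha> r + \<mu> \<le> 0\<close>.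
\<close>

section \<open>Roots of the characteristic quadratics\<close>

lemma characteristic_roots:
  fixes s b g :: real
  assumes "s > 0" "g > 0"
  defines "d \<equiv> sqrt (b\<^sup>2 + 2 * g * s)"
  shows "(- b + d) / s > 0" "(- b - d) / s < 0"
    and "s / 2 * ((- b + d) / s)\<^sup>2 + b * ((- b + d) / s) - g = 0"
    and "s / 2 * ((- b - d) / s)\<^sup>2 + b * ((- b - d) / s) - g = 0"
proof -
  have gs: "g * s > 0"
    using assms by simp
  have d2: "d\<^sup>2 = b\<^sup>2 + 2 * g * s"
    unfolding d_def using gs by (intro real_sqrt_pow2) (simp add: add_nonneg_nonneg)
  have "sqrt (b\<^sup>2) < d"
    unfolding d_def using gs by (intro real_sqrt_less_mono) simp
  then have "\<bar>b\<bar> < d"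
    by simp
  then show "(- b + d) / s > 0" "(- b - d) / s < 0"
    using assms by (auto simp: divide_simps)
  show "s / 2 * ((- b + d) / s)\<^sup>2 + b * ((- b + d) / s) - g = 0"
    using d2 assms(1) by (simp add: field_simps power2_eq_square)
  show "s / 2 * ((- b - d) / s)\<^sup>2 + b * ((- b - d) / s) - g = 0"
    using d2 assms(1) by (simp add: field_simps power2_eq_square)
qed

text \<open>Dividing out the root \<open>r\<close> leaves \<open>q y = (y - r) (s/2 y + g/r)\<close>, and the second factor is
  negative when \<open>y < 0\<close>.\<close>

lemma less_negative_root_iff:
  fixes s b g r y :: real
  assumes "s > 0" "g > 0" "r < 0" "y < 0" and root: "s / 2 * r\<^sup>2 + b * r - g = 0"
  shows "y < r \<longleftrightarrow> s / 2 * y\<^sup>2 + b * y - g > 0"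
proof -
  have b: "b = g / r - s / 2 * r"
    using root \<open>r < 0\<close> by (simp add: field_simps power2_eq_square)
  have "s / 2 * y\<^sup>2 + b * y - g = (y - r) * (s / 2 * y + g / r)"
    unfolding b using \<open>r < 0\<close> by (simp add: field_simps power2_eq_square)
  moreover have "s / 2 * y + g / r < 0"
    using assms by (intro add_neg_neg) (simp_all add: mult_pos_neg divide_pos_neg)
  ultimately show ?thesis
    by (simp add: zero_less_mult_iff)
qed

lemma sum_of_roots:
  fixes s b g p q :: real
  assumes "s \<noteq> 0" "p \<noteq> q"
    and "s / 2 * p\<^sup>2 + b * p - g = 0" "s / 2 * q\<^sup>2 + b * q - g = 0"
  shows "p + q = - 2 * b / s"
proof -
  have "(p - q) * (s / 2 * (p + q) + b) = (s / 2 * p\<^sup>2 + b * p - g) - (s / 2 * q\<^sup>2 + b * q - g)"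
    by (simp add: field_simps power2_eq_square)
  also have "\<dots> = 0"
    unfolding assms(3,4) by simp
  finally have "(p - q) * (s / 2 * (p + q) + b) = 0" .
  then have "s / 2 * (p + q) + b = 0"
    using assms(2) by simp
  then show ?thesis
    using assms(1) by (simp add: field_simps)
qed

section \<open>Gluing functions at a point\<close>

lemma DERIV_glue:
  fixes f g f' g' :: "real \<Rightarrow> real"
  assumes f: "\<And>x. (f has_real_derivative f' x) (at x)"
    and g: "\<And>x. (g has_real_derivative g' x) (at x)"
    and eq: "f a = g a" "f' a = g' a"
  shows "((\<lambda>x. if x < a then f x else g x) has_real_derivative (if x < a then f' x else g' x)) (at x)"
proof -
  have "((\<lambda>x. if x \<in> {..<a} then f x else g x) has_vector_derivative
      (if x \<in> {..<a} then f' x else g' x)) (at x within UNIV)"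
  proof (rule has_vector_derivative_If_within_closures[where T = "{a..}"])
    show "(f has_vector_derivative f' x) (at x within S)" for S
      using f has_field_derivative_at_within has_real_derivative_iff_has_vector_derivative by blast
    show "(g has_vector_derivative g' x) (at x within S)" for S
      using g has_field_derivative_at_within has_real_derivative_iff_has_vector_derivative by blast
    show "f x = g x" "f' x = g' x" if "x \<in> closure {..<a}" "x \<in> closure {a..}"
      using that eq by (simp_all add: order_antisym)
  qed auto
  then show ?thesis
    by (simp add: has_real_derivative_iff_has_vector_derivative)
qed

lemma continuous_on_glue:
  fixes f g :: "real \<Rightarrow> real"
  assumes "continuous_on UNIV f" "continuous_on UNIV g" "f a = g a"
  shows "continuous_on S (\<lambda>x. if x < a then f x else g x)"
proof -
  have "continuous_on UNIV (\<lambda>x. if x \<le> a then f x else g x)"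
  proof (rule continuous_on_cases_le)
    show "continuous_on {x \<in> UNIV. x \<le> a} f" "continuous_on {x \<in> UNIV. a \<le> x} g"
      using assms continuous_on_subset by blast+
  qed (use assms(3) in auto)
  moreover have "(\<lambda>x. if x \<le> a then f x else g x) = (\<lambda>x. if x < a then f x else g x)"
    using assms(3) by (simp add: fun_eq_iff less_le)
  ultimately have "continuous_on UNIV (\<lambda>x. if x < a then f x else g x)"
    by (simp only:)
  then show ?thesis
    by (rule continuous_on_subset) (rule subset_UNIV)
qed

section \<open>The candidate for a fixed control\<close>

text \<open>The data of the candidate, separated from the closed formulas for the roots: \<open>p\<close> and \<open>q\<close>
  stand for \<open>r\<^sub>+\<close> and \<open>r\<^sub>-\<close>, and \<open>r\<close> for the root \<open>\<tilde>r\<^sub>-\<close> governing the region of payments.\<close>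

locale smooth_fit =
  fixes s c \<gamma> M p q r :: real
  assumes s_pos: "s > 0" and \<gamma>_pos: "\<gamma> > 0" and M_pos: "M > 0"
    and p_pos: "p > 0" and q_neg: "q < 0" and r_neg: "r < 0"
    and p_root: "s / 2 * p\<^sup>2 + c * p - \<gamma> = 0"
    and q_root: "s / 2 * q\<^sup>2 + c * q - \<gamma> = 0"
    and r_root: "s / 2 * r\<^sup>2 + (c - M) * r - \<gamma> = 0"
    and c_pos: "c > 0" and M_lower: "s * \<gamma> / (2 * c) < M"
begin

definition x1 :: real where
  "x1 = 1 / (p - q) * ln (q * (q - r) / (p * (p - r)))"

definition k :: real where
  "k = 1 / (p * exp (p * x1) - q * exp (q * x1))"

definition V :: "real \<Rightarrow> real" where
  "V x = (if x < x1 then k * (exp (p * x) - exp (q * x)) else M / \<gamma> + 1 / r * exp (r * (x - x1)))"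

definition V' :: "real \<Rightarrow> real" where
  "V' x = (if x < x1 then k * (p * exp (p * x) - q * exp (q * x)) else exp (r * (x - x1)))"

definition V'' :: "real \<Rightarrow> real" where
  "V'' x = (if x < x1 then k * (p\<^sup>2 * exp (p * x) - q\<^sup>2 * exp (q * x)) else r * exp (r * (x - x1)))"

text \<open>At \<open>q\<close> the quadratic of \<open>r\<close> takes the value \<open>- M q > 0\<close>.\<close>

lemma q_less_r: "q < r"
proof -
  have "s / 2 * q\<^sup>2 + (c - M) * q - \<gamma> = - (M * q)"
    using q_root by (simp add: algebra_simps)
  also have "\<dots> > 0"
    using M_pos q_neg by (simp add: mult_pos_neg)
  finally show ?thesis
    using less_negative_root_iff[OF s_pos \<gamma>_pos r_neg q_neg r_root] by simp
qed

text \<open>At \<open>p + q = - 2c/s\<close> the quadratic of \<open>r\<close> takes the value \<open>2cM/s - \<gamma>\<close>, which the lower bound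
  on \<open>M\<close> makes positive.\<close>

lemma p_plus_q_less_r: "p + q < r"
proof -
  have sum: "p + q = - 2 * c / s"
    using s_pos p_pos q_neg p_root q_root by (intro sum_of_roots) auto
  have neg: "- 2 * c / s < 0"
    using s_pos c_pos by (simp add: divide_neg_pos)
  have "s / 2 * (- 2 * c / s)\<^sup>2 + (c - M) * (- 2 * c / s) - \<gamma> = 2 * c * M / s - \<gamma>"
    using s_pos by (simp add: field_simps power2_eq_square)
  also have "\<dots> > 0"
    using M_lower c_pos s_pos by (simp add: field_simps)
  finally show ?thesis
    unfolding sum using less_negative_root_iff[OF s_pos \<gamma>_pos r_neg neg r_root] by simp
qed

lemma weight_p_pos: "p * (p - r) > 0"
  using p_pos r_neg by simp

lemma weight_q_pos: "q * (q - r) > 0"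
  using q_neg q_less_r by (simp add: mult_neg_neg)

text \<open>Positivity of \<open>x\<^sub>1\<close> means \<open>q (q - r) > p (p - r)\<close>, and the difference of the two sides is
  \<open>(p - q) (r - p - q)\<close>.\<close>

lemma x1_pos: "x1 > 0"
proof -
  have "(p - q) * (r - (p + q)) > 0"
    using p_pos q_neg p_plus_q_less_r by simp
  then have "q * (q - r) > p * (p - r)"
    by (simp add: algebra_simps)
  then have "q * (q - r) / (p * (p - r)) > 1"
    using weight_p_pos by simp
  then show ?thesis
    unfolding x1_def using p_pos q_neg by simp
qed

text \<open>This balance is the equation \<open>V'' = r V'\<close> at \<open>x\<^sub>1\<close>.\<close>

lemma balance_at_x1: "p * (p - r) * exp (p * x1) = q * (q - r) * exp (q * x1)"
proof -
  have "(p - q) * x1 = ln (q * (q - r) / (p * (p - r)))"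
    unfolding x1_def using p_pos q_neg by simp
  then have "exp ((p - q) * x1) = q * (q - r) / (p * (p - r))"
    using weight_p_pos weight_q_pos by simp
  moreover have "exp (p * x1) = exp ((p - q) * x1) * exp (q * x1)"
    by (simp add: algebra_simps flip: exp_add)
  ultimately show ?thesis
    using p_pos r_neg by simp
qed

lemma exp_combination_pos: "p * exp (p * x) - q * exp (q * x) > 0"
  using p_pos mult_neg_pos[OF q_neg exp_gt_zero, of "q * x"]
  by (smt (verit) exp_gt_zero mult_pos_pos)

lemma k_pos: "k > 0"
  unfolding k_def using exp_combination_pos by simp

lemma V'_pos: "V' x > 0"
  unfolding V'_def using exp_combination_pos k_pos by simp

text \<open>To the left of \<open>x\<^sub>1\<close>, \<open>exp (p (x - x\<^sub>1)) \<le> exp (q (x - x\<^sub>1))\<close> weighs against the balance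
  at \<open>x\<^sub>1\<close>.\<close>

lemma V''_le: "V'' x \<le> r * V' x"
proof (cases "x < x1")
  case True
  have "p * (x - x1) \<le> 0" "q * (x - x1) \<ge> 0"
    using True p_pos q_neg by (simp_all add: mult_nonneg_nonpos mult_nonpos_nonpos)
  then have le: "exp (p * (x - x1)) \<le> exp (q * (x - x1))"
    by (simp only: exp_le_cancel_iff)
  have shift: "exp (a * x) = exp (a * x1) * exp (a * (x - x1))" for a
    by (simp add: algebra_simps flip: exp_add)
  have "p * (p - r) * exp (p * x) = q * (q - r) * exp (q * x1) * exp (p * (x - x1))"
    unfolding shift[of p] using balance_at_x1 by simp
  also have "\<dots> \<le> q * (q - r) * exp (q * x1) * exp (q * (x - x1))"
    using le weight_q_pos by (intro mult_left_mono) auto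
  also have "\<dots> = q * (q - r) * exp (q * x)"
    unfolding shift[of q] by simp
  finally have "k * (p * (p - r) * exp (p * x)) \<le> k * (q * (q - r) * exp (q * x))"
    using k_pos by simp
  then show ?thesis
    unfolding V'_def V''_def using True by (simp add: algebra_simps power2_eq_square)
qed (simp add: V'_def V''_def)

lemma V''_neg: "V'' x < 0"
  using V''_le[of x] mult_neg_pos[OF r_neg V'_pos, of x] by simp

lemma V'_fit: "k * (p * exp (p * x1) - q * exp (q * x1)) = 1"
  unfolding k_def using exp_combination_pos[of x1] by simp

lemma V''_fit: "k * (p\<^sup>2 * exp (p * x1) - q\<^sup>2 * exp (q * x1)) = r"
proof -
  have "p\<^sup>2 * exp (p * x1) - q\<^sup>2 * exp (q * x1) = r * (p * exp (p * x1) - q * exp (q * x1))"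
    using balance_at_x1 by (simp add: algebra_simps power2_eq_square)
  then show ?thesis
    using V'_fit by (simp add: mult.left_commute)
qed

lemma left_ode:
  "s / 2 * (k * (p\<^sup>2 * exp (p * x) - q\<^sup>2 * exp (q * x))) + c * (k * (p * exp (p * x) - q * exp (q * x)))
    - \<gamma> * (k * (exp (p * x) - exp (q * x))) = 0" (is "?lhs = 0")
proof -
  have "?lhs = k * ((s / 2 * p\<^sup>2 + c * p - \<gamma>) * exp (p * x) - (s / 2 * q\<^sup>2 + c * q - \<gamma>) * exp (q * x))"
    by (simp add: algebra_simps)
  then show ?thesis
    unfolding p_root q_root by simp
qed

lemma right_ode_coefficient: "s / 2 * r + c - M - \<gamma> / r = 0"
  using r_root r_neg by (simp add: field_simps power2_eq_square)

text \<open>With \<open>V' = 1\<close> and \<open>V'' = r\<close> at \<open>x\<^sub>1\<close>, both equations determine the same value \<open>V x\<^sub>1\<close>.\<close>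

lemma V_fit: "k * (exp (p * x1) - exp (q * x1)) = M / \<gamma> + 1 / r"
proof -
  have "\<gamma> * (k * (exp (p * x1) - exp (q * x1))) = s / 2 * r + c"
    using left_ode[of x1] unfolding V'_fit V''_fit by simp
  also have "\<dots> = \<gamma> * (M / \<gamma> + 1 / r)"
    using right_ode_coefficient \<gamma>_pos by (simp add: algebra_simps)
  finally show ?thesis
    using \<gamma>_pos by simp
qed

lemma DERIV_V: "(V has_real_derivative V' x) (at x)"
  unfolding V_def V'_def
proof (rule DERIV_glue)
  show "((\<lambda>x. k * (exp (p * x) - exp (q * x))) has_real_derivative
      k * (p * exp (p * x) - q * exp (q * x))) (at x)" for x
    by (auto intro!: derivative_eq_intros)
  show "((\<lambda>x. M / \<gamma> + 1 / r * exp (r * (x - x1))) has_real_derivative exp (r * (x - x1))) (at x)" for x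
    using r_neg by (auto intro!: derivative_eq_intros)
qed (use V_fit V'_fit in simp_all)

lemma DERIV_V': "(V' has_real_derivative V'' x) (at x)"
  unfolding V'_def V''_def
proof (rule DERIV_glue)
  show "((\<lambda>x. k * (p * exp (p * x) - q * exp (q * x))) has_real_derivative
      k * (p\<^sup>2 * exp (p * x) - q\<^sup>2 * exp (q * x))) (at x)" for x
    by (auto intro!: derivative_eq_intros simp: power2_eq_square)
  show "((\<lambda>x. exp (r * (x - x1))) has_real_derivative r * exp (r * (x - x1))) (at x)" for x
    by (auto intro!: derivative_eq_intros)
qed (use V'_fit V''_fit in simp_all)

lemma continuous_on_V'': "continuous_on S V''"
  unfolding V''_def
proof (rule continuous_on_glue)
  show "continuous_on UNIV (\<lambda>x. k * (p\<^sup>2 * exp (p * x) - q\<^sup>2 * exp (q * x)))"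
    by (intro continuous_intros)
  show "continuous_on UNIV (\<lambda>x. r * exp (r * (x - x1)))"
    by (intro continuous_intros)
qed (use V''_fit in simp)

lemma concave_on_V: "convex S \<Longrightarrow> concave_on S V"
  by (rule f''_le0_imp_concave[OF _ DERIV_V DERIV_V' less_imp_le[OF V''_neg]])

lemma V_mono: "x \<le> y \<Longrightarrow> V x \<le> V y"
  by (rule DERIV_nonneg_imp_nondecreasing) (meson DERIV_V V'_pos less_imp_le)+

lemma V'_antimono: "x \<le> y \<Longrightarrow> V' y \<le> V' x"
  by (rule DERIV_nonpos_imp_nonincreasing) (meson DERIV_V' V''_neg less_imp_le)+

lemma V_zero: "V 0 = 0"
  unfolding V_def using x1_pos by simp

lemma V_le: "V x \<le> M / \<gamma>"
proof -
  have "V x \<le> V (max x x1)"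
    by (intro V_mono) simp
  also have "\<dots> \<le> M / \<gamma>"
    unfolding V_def using r_neg by (simp add: divide_nonneg_neg)
  finally show ?thesis .
qed

text \<open>Since \<open>V'\<close> decreases through \<open>1\<close> at \<open>x\<^sub>1\<close>, the positive part is active exactly on the right
  branch.\<close>

lemma HJB_equality: "s / 2 * V'' x + c * V' x - \<gamma> * V x + M * max (1 - V' x) 0 = 0"
proof (cases "x < x1")
  case True
  have "V' x \<ge> V' x1"
    using True by (intro V'_antimono) simp
  then have "max (1 - V' x) 0 = 0"
    by (simp add: V'_def)
  then show ?thesis
    using left_ode[of x] True by (simp add: V_def V'_def V''_def)
next
  case False
  have "V' x \<le> V' x1"
    using False by (intro V'_antimono) simp
  then have m: "max (1 - V' x) 0 = 1 - V' x"
    by (simp add: V'_def)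
  have "s / 2 * V'' x + c * V' x - \<gamma> * V x + M * (1 - V' x)
      = (s / 2 * r + c - M - \<gamma> / r) * exp (r * (x - x1))"
    using False \<gamma>_pos by (simp add: V_def V'_def V''_def algebra_simps)
  then show ?thesis
    unfolding m right_ode_coefficient by simp
qed

end

section \<open>Optimality of the smallest control\<close>

text \<open>The expression is quadratic in the control, so its Taylor expansion at \<open>\<alpha>\<close> is exact:
  the first-order coefficient is \<open>\<sigma>\<^sup>2\<alpha> v'' + \<mu> v'\<close> and the second-order one is a positive multiple
  of \<open>v''\<close>.\<close>

lemma HJB_op_le_at_lower_control:
  assumes "\<alpha> \<le> a" "v2 \<le> 0" "\<sigma>\<^sup>2 * \<alpha> * v2 + \<mu> * v1 \<le> 0"
  shows "HJB_op \<mu> \<sigma> \<gamma> \<delta> M a v v1 v2 \<le> HJB_op \<mu> \<sigma> \<gamma> \<delta> M \<alpha> v v1 v2"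
proof -
  have "HJB_op \<mu> \<sigma> \<gamma> \<delta> M a v v1 v2 - HJB_op \<mu> \<sigma> \<gamma> \<delta> M \<alpha> v v1 v2
      = (a - \<alpha>) * (\<sigma>\<^sup>2 * \<alpha> * v2 + \<mu> * v1) + (\<sigma>\<^sup>2 * (a - \<alpha>)\<^sup>2 / 2) * v2"
    unfolding HJB_op_def by (simp add: field_simps power2_eq_square)
  also have "\<dots> \<le> 0"
    using assms by (intro add_nonpos_nonpos mult_nonneg_nonpos[OF _ assms(2)]
        mult_nonneg_nonpos[OF _ assms(3)]) auto
  finally show ?thesis
    by simp
qed

text \<open>The quadratic of \<open>r\<close> is nonpositive at \<open>- \<mu>/(\<sigma>\<^sup>2\<alpha>)\<close> exactly when \<open>M\<close> obeys its upper bound.\<close>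

lemma negative_root_le_of_M_upper:
  fixes \<mu> \<sigma> \<gamma> \<delta> M \<alpha> r :: real
  assumes pos: "\<mu> > 0" "\<sigma> > 0" "\<gamma> > 0" "\<alpha> > 0" and "r < 0"
    and root: "\<sigma>\<^sup>2 * \<alpha>\<^sup>2 / 2 * r\<^sup>2 + (\<alpha> * \<mu> - \<delta> - M) * r - \<gamma> = 0"
    and M: "M \<le> M_upper \<mu> \<sigma> \<gamma> \<delta> \<alpha>"
  shows "\<sigma>\<^sup>2 * \<alpha> * r + \<mu> \<le> 0"
proof -
  define y where "y = - \<mu> / (\<sigma>\<^sup>2 * \<alpha>)"
  have y: "y < 0"
    unfolding y_def using pos by (simp add: divide_neg_pos)
  have s: "\<sigma>\<^sup>2 * \<alpha>\<^sup>2 > 0"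
    using pos by simp
  have ne: "\<mu>\<^sup>2 + 2 * \<gamma> * \<sigma>\<^sup>2 > 0"
    using pos by (intro add_pos_pos) auto
  have "M_upper \<mu> \<sigma> \<gamma> \<delta> \<alpha> = \<alpha> * (\<mu>\<^sup>2 + 2 * \<gamma> * \<sigma>\<^sup>2) / (2 * \<mu>) - \<delta>"
    unfolding M_upper_def left_diff_distrib using ne pos(1) by simp
  then have "2 * \<mu> * (M_upper \<mu> \<sigma> \<gamma> \<delta> \<alpha> + \<delta>) = \<alpha> * (\<mu>\<^sup>2 + 2 * \<gamma> * \<sigma>\<^sup>2)"
    using pos(1) by simp
  moreover have "2 * \<mu> * (M + \<delta>) \<le> 2 * \<mu> * (M_upper \<mu> \<sigma> \<gamma> \<delta> \<alpha> + \<delta>)"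
    using M pos(1) by simp
  ultimately have "2 * \<mu> * (M + \<delta>) \<le> \<alpha> * (\<mu>\<^sup>2 + 2 * \<gamma> * \<sigma>\<^sup>2)"
    by simp
  then have "(2 * \<mu> * (M + \<delta>) - \<alpha> * (\<mu>\<^sup>2 + 2 * \<gamma> * \<sigma>\<^sup>2)) / (2 * \<sigma>\<^sup>2 * \<alpha>) \<le> 0"
    using pos by (intro divide_nonpos_pos) auto
  also have "(2 * \<mu> * (M + \<delta>) - \<alpha> * (\<mu>\<^sup>2 + 2 * \<gamma> * \<sigma>\<^sup>2)) / (2 * \<sigma>\<^sup>2 * \<alpha>)
      = \<sigma>\<^sup>2 * \<alpha>\<^sup>2 / 2 * y\<^sup>2 + (\<alpha> * \<mu> - \<delta> - M) * y - \<gamma>"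
    unfolding y_def using pos by (simp add: field_simps power2_eq_square)
  finally have "r \<le> y"
    using less_negative_root_iff[OF s pos(3) \<open>r < 0\<close> y root] by simp
  then show ?thesis
    unfolding y_def using pos by (simp add: field_simps)
qed

theorem theorem3p11:
  fixes \<mu> \<sigma> \<gamma> \<delta> M \<alpha> \<beta> :: real and V :: "real \<Rightarrow> real"
  assumes "\<mu> > 0" "\<sigma> > 0" "\<gamma> > 0" "\<delta> \<ge> 0" "M > 0" "0 < \<alpha>" "\<alpha> < \<beta>"
    and "2 * \<delta> / \<mu> < \<alpha>"
    and "M_zero \<mu> \<sigma> \<gamma> \<delta> \<alpha> < M" "M \<le> M_upper \<mu> \<sigma> \<gamma> \<delta> \<alpha>"
  defines "V \<equiv> V_cand \<mu> \<sigma> \<gamma> \<delta> M \<alpha>"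
  shows "concave_on {0..} V \<and>
    (\<exists>V' V''. has_C2_derivs_on V V' V'' {0..} \<and>
       (\<forall>x\<ge>0. is_maximum 0 ((\<lambda>a. HJB_op \<mu> \<sigma> \<gamma> \<delta> M a (V x) (V' x) (V'' x)) ` {\<alpha>..\<beta>}))) \<and>
    V 0 = 0 \<and>
    (\<forall>x>0. 0 \<le> V x \<and> V x \<le> M / \<gamma>)"
proof -
  define s c where "s = \<sigma>\<^sup>2 * \<alpha>\<^sup>2" and "c = \<alpha> * \<mu> - \<delta>"
  define p q r where "p = r_plus \<mu> \<sigma> \<gamma> \<delta> \<alpha>" and "q = r_minus \<mu> \<sigma> \<gamma> \<delta> \<alpha>"
    and "r = rt_minus \<mu> \<sigma> \<gamma> \<delta> M \<alpha>"
  have s: "s > 0"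
    using assms by (simp add: s_def)
  have "2 * \<delta> < \<alpha> * \<mu>"
    using assms(1,8) by (simp add: field_simps)
  then have c: "c > 0"
    using assms(4) by (simp add: c_def)
  have p_eq: "p = (- c + sqrt (c\<^sup>2 + 2 * \<gamma> * s)) / s"
    and q_eq: "q = (- c - sqrt (c\<^sup>2 + 2 * \<gamma> * s)) / s"
    and r_eq: "r = (- (c - M) - sqrt ((c - M)\<^sup>2 + 2 * \<gamma> * s)) / s"
    by (simp_all add: p_def q_def r_def r_plus_def r_minus_def rt_minus_def s_def c_def mult.assoc)
  have roots: "p > 0" "q < 0" "s / 2 * p\<^sup>2 + c * p - \<gamma> = 0" "s / 2 * q\<^sup>2 + c * q - \<gamma> = 0"
    unfolding p_eq q_eq by (rule characteristic_roots[OF s assms(3)])+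
  have r_root: "r < 0" "s / 2 * r\<^sup>2 + (c - M) * r - \<gamma> = 0"
    unfolding r_eq by (rule characteristic_roots[OF s assms(3)])+
  interpret W: smooth_fit s c \<gamma> M p q r
  proof
    show "s * \<gamma> / (2 * c) < M"
      using assms(9) by (simp add: M_zero_def s_def c_def mult_ac)
  qed (fact s c roots r_root assms)+
  have x1: "x_one \<mu> \<sigma> \<gamma> \<delta> M \<alpha> = W.x1"
    by (simp add: x_one_def W.x1_def Let_def flip: p_def q_def r_def)
  have "k_one \<mu> \<sigma> \<gamma> \<delta> M \<alpha> = (THE k. k * (p * exp (p * W.x1) - q * exp (q * W.x1)) = 1)"
    by (simp add: k_one_def x1 Let_def flip: p_def q_def)
  also have "\<dots> = W.k"
    using W.exp_combination_pos[of W.x1] by (intro the_equality) (auto simp: W.k_def field_simps)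
  finally have V: "V = W.V"
    by (auto simp: fun_eq_iff V_def V_cand_def W.V_def x1 Let_def simp flip: p_def q_def r_def)
  have slope: "\<sigma>\<^sup>2 * \<alpha> * r + \<mu> \<le> 0"
    by (rule negative_root_le_of_M_upper[where \<delta> = \<delta> and M = M])
      (use assms W.r_neg W.r_root in \<open>simp_all add: s_def c_def\<close>)
  have max: "is_maximum 0 ((\<lambda>a. HJB_op \<mu> \<sigma> \<gamma> \<delta> M a (W.V x) (W.V' x) (W.V'' x)) ` {\<alpha>..\<beta>})" for x
  proof -
    have zero: "HJB_op \<mu> \<sigma> \<gamma> \<delta> M \<alpha> (W.V x) (W.V' x) (W.V'' x) = 0"
      using W.HJB_equality[of x] by (simp add: HJB_op_def s_def c_def)
    have "\<sigma>\<^sup>2 * \<alpha> * W.V'' x + \<mu> * W.V' x \<le> \<sigma>\<^sup>2 * \<alpha> * (r * W.V' x) + \<mu> * W.V' x"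
      using W.V''_le[of x] assms(2,6) by simp
    also have "\<dots> = (\<sigma>\<^sup>2 * \<alpha> * r + \<mu>) * W.V' x"
      by (simp add: algebra_simps)
    also have "\<dots> \<le> 0"
      using slope W.V'_pos[of x] by (simp add: mult_nonpos_nonneg)
    finally have "HJB_op \<mu> \<sigma> \<gamma> \<delta> M a (W.V x) (W.V' x) (W.V'' x) \<le> 0" if "\<alpha> \<le> a" for a
      using HJB_op_le_at_lower_control[OF that less_imp_le[OF W.V''_neg]] zero by metis
    then show ?thesis
      unfolding is_maximum_def using zero assms(7) by (force intro: image_eqI[where x = \<alpha>])
  qed
  have "has_C2_derivs_on W.V W.V' W.V'' {0..}"
    unfolding has_C2_derivs_on_def
    using W.DERIV_V W.DERIV_V' W.continuous_on_V'' by (auto intro: has_field_derivative_at_within)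
  moreover have "0 \<le> W.V x" if "x > 0" for x
    using W.V_mono[of 0 x] W.V_zero that by simp
  ultimately show ?thesis
    unfolding V using W.concave_on_V[of "{0..}"] W.V_zero W.V_le max by blast
qed

end
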